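(* Let $\mathcal{S}$ be a Simplex (congruence class of simplices) with vertices indexed by a finite set $\mathcal{N}$, let $\mathcal{V}\subset\mathcal{N}$ be a nonempty proper subset, and write $\mathcal{V}^c=\mathcal{N}\setminus\mathcal{V}$. Let $\mathcal{S}/\mathcal{V}^c$ denote the $\mathcal{V}$-face of $\mathcal{S}$. Then the canonical pseudoinverse Gram matrix of the face is equal to the Schur complement of the canonical pseudoinverse Gram matrix of the Simplex: $$M^\dagger(\mathcal{S}/\mathcal{V}^c)=M^\dagger(\mathcal{S})/\mathcal{V}^c .$$
   Context: Simplices: a set of $n$ points $s_1,\dots,s_n$ in $\mathbb{R}^{n-1}$ (or in an $(n-1)$-dimensional affine subspace of a larger Euclidean space) that are affinely independent, i.e. such that for any $j$ the vectors $\{s_i-s_j\}_{i\neq j}$ are linearly independent, determines a simplex $S$ (their convex hull) with these points as vertices; the indices $i$ range over the set $\mathcal{N}$, $|\mathcal{N}|=n$. We also write $S=[s_1~\dots~s_n]$ for the matrix whose columns are the vertices. Let $u$ denote the all-one vector of the appropriate dimension. Two simplices are equivalent, $S\sim S'$, if $S'=OS+xu^T$ for some orthogonal matrix $O$ and vector $x$ (congruence preserving the labelling of vertices). A Simplex (upper case) $\mathcal{S}$ is an equivalence class of simplices under $\sim$. Canonical Gram matrix: for a Simplex $\mathcal{S}$ on $n$ vertices, $M(\mathcal{S})=(I-uu^T/n)^TS^TS(I-uu^T/n)$ for any representative $S\in\mathcal{S}$; this does not depend on the choice of $S$. The canonical pseudoinverse Gram matrix $M^\dagger(\mathcal{S})$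 is the Moore-Penrose pseudoinverse of $M(\mathcal{S})$. Faces: for $\mathcal{V}\subseteq\mathcal{N}$ nonempty and $S\in\mathcal{S}$, $S_{\mathcal{V}}$ is the simplex with vertices $\{s_i\}_{i\in\mathcal{V}}$. The $\mathcal{V}$-face of $\mathcal{S}$ is the Simplex $\mathcal{S}/\mathcal{V}^c=\{S':S'\sim S_{\mathcal{V}}\}$ (independent of the representative $S$). Schur complement: for a square matrix $A$ with rows and columns indexed by $\mathcal{N}$ such that $A_{\mathcal{V}^c\mathcal{V}^c}$ is invertible, $A/\mathcal{V}^c = A_{\mathcal{V}\mathcal{V}}-A_{\mathcal{V}\mathcal{V}^c}(A_{\mathcal{V}^c\mathcal{V}^c})^{-1}A_{\mathcal{V}^c\mathcal{V}}$. For $A=M^\dagger(\mathcal{S})$ and any nonempty proper subset $\mathcal{V}\subset\mathcal{N}$ the block $A_{\mathcal{V}^c\mathcal{V}^c}$ is invertible. *)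

theory Defs
  imports "HOL-Analysis.Analysis"
begin

text \<open>
  The vertex set \<open>\<N>\<close> is the finite type \<open>'n\<close>. A simplex is the \<open>'d \<times> 'n\<close> matrix whose columns are
  its vertices; \<open>'d\<close> is arbitrary, so the simplex may span a proper affine subspace of the ambient space.
  A nonempty subset \<open>\<V>\<close> of \<open>\<N>\<close> is given together with an enumeration \<open>\<iota> :: 'v \<Rightarrow> 'n\<close>, a bijection
  from a finite type onto \<open>\<V>\<close>. Matrices with rows or columns indexed by \<open>\<V>\<close> are matrices over the index
  type \<open>'v\<close>, where \<open>a :: 'v\<close> stands for the vertex \<open>\<iota> a\<close>.
\<close>

definition outer_prod :: "real^'m \<Rightarrow> real^'n \<Rightarrow> real^'n^'m" where
  "outer_prod x y = (columnvector x :: real^1^'m) ** (rowvector y :: real^'n^1)"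

lemma outer_prod_nth: "outer_prod x y $ i $ j = x $ i * y $ j"
  by (simp add: outer_prod_def matrix_matrix_mult_def columnvector_def rowvector_def)

definition is_simplex :: "real^'n^'d \<Rightarrow> bool" where
  "is_simplex S \<longleftrightarrow> (\<forall>j. inj_on (\<lambda>i. column i S - column j S) (- {j}) \<and>
                        independent ((\<lambda>i. column i S - column j S) ` (- {j})))"

text \<open>The all-one vector is \<open>1 :: real^'n\<close>.\<close>

definition simplex_equiv :: "((real^'n^'d) \<times> (real^'n^'d)) set" where
  "simplex_equiv = {(S, S'). is_simplex S \<and> is_simplex S' \<and>
     (\<exists>Q x. orthogonal_matrix Q \<and> S' = Q ** S + outer_prod x 1)}"

definition Simplices :: "(real^'n^'d) set set" where
  "Simplices = {S. is_simplex S} // simplex_equiv"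

definition centering :: "real^'n^'n" where
  "centering = mat 1 - (1 / real CARD('n)) *\<^sub>R outer_prod 1 1"

definition simplex_gram :: "real^'n^'d \<Rightarrow> real^'n^'n" where
  "simplex_gram S = transpose centering ** transpose S ** S ** centering"

definition canonical_gram :: "(real^'n^'d) set \<Rightarrow> real^'n^'n" where
  "canonical_gram \<S> = simplex_gram (SOME S. S \<in> \<S>)"

definition is_pseudoinverse :: "real^'n^'m \<Rightarrow> real^'m^'n \<Rightarrow> bool" where
  "is_pseudoinverse A X \<longleftrightarrow> A ** X ** A = A \<and> X ** A ** X = X \<and>
     transpose (A ** X) = A ** X \<and> transpose (X ** A) = X ** A"

definition pseudoinverse :: "real^'n^'m \<Rightarrow> real^'m^'n" where
  "pseudoinverse A = (THE X. is_pseudoinverse A X)"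

definition canonical_pinv_gram :: "(real^'n^'d) set \<Rightarrow> real^'n^'n" where
  "canonical_pinv_gram \<S> = pseudoinverse (canonical_gram \<S>)"

definition sub_matrix :: "('p \<Rightarrow> 'm) \<Rightarrow> ('q \<Rightarrow> 'n) \<Rightarrow> real^'n^'m \<Rightarrow> real^'q^'p" where
  "sub_matrix \<rho> \<sigma> A = (\<chi> a b. A $ \<rho> a $ \<sigma> b)"

text \<open>
  For \<open>\<iota>\<close> enumerating \<open>\<V>\<close>, \<open>sub_matrix id \<iota> S\<close> is the simplex with the vertices of \<open>S\<close> in \<open>\<V>\<close>, and
  \<open>face \<iota> \<S>\<close> is the \<open>\<V>\<close>-face of \<open>\<S>\<close>. The union over all representatives in the image is the class
  obtained from any one of them.
\<close>

definition face :: "('v \<Rightarrow> 'n) \<Rightarrow> (real^'n^'d) set \<Rightarrow> (real^'v^'d) set" where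
  "face \<iota> \<S> = simplex_equiv `` (sub_matrix id \<iota> ` \<S>)"

text \<open>Here \<open>\<iota>\<close> enumerates \<open>\<V>\<close> and \<open>\<kappa>\<close> enumerates the complement of \<open>\<V>\<close>.\<close>

definition schur_complement :: "('v \<Rightarrow> 'n) \<Rightarrow> ('w::finite \<Rightarrow> 'n) \<Rightarrow> real^'n^'n \<Rightarrow> real^'v^'v" where
  "schur_complement \<iota> \<kappa> A =
     sub_matrix \<iota> \<iota> A -
     sub_matrix \<iota> \<kappa> A ** matrix_inv (sub_matrix \<kappa> \<kappa> A) ** sub_matrix \<kappa> \<iota> A"


subsection \<open>Well-definedness\<close>

lemma is_pseudoinverse_unique:
  assumes X: "is_pseudoinverse A X" and Y: "is_pseudoinverse A Y"
  shows "X = Y"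
proof -
  have "A ** X = transpose (A ** X)" using X by (simp add: is_pseudoinverse_def)
  also have "\<dots> = transpose ((A ** Y) ** (A ** X))"
    using Y by (simp add: is_pseudoinverse_def matrix_mul_assoc)
  also have "\<dots> = (A ** X) ** (A ** Y)"
    using X Y by (simp only: matrix_transpose_mul is_pseudoinverse_def)
  also have "\<dots> = A ** Y" using X by (simp add: is_pseudoinverse_def matrix_mul_assoc)
  finally have 1: "A ** X = A ** Y" .
  have "X ** A = transpose (X ** A)" using X by (simp add: is_pseudoinverse_def)
  also have "\<dots> = transpose ((X ** A) ** (Y ** A))"
    using Y by (simp add: is_pseudoinverse_def flip: matrix_mul_assoc)
  also have "\<dots> = (Y ** A) ** (X ** A)"
    using X Y by (simp only: matrix_transpose_mul is_pseudoinverse_def)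
  also have "\<dots> = Y ** A" using X by (simp add: is_pseudoinverse_def flip: matrix_mul_assoc)
  finally have 2: "X ** A = Y ** A" .
  have "X = X ** A ** X" using X by (simp add: is_pseudoinverse_def)
  also have "\<dots> = Y ** (A ** X)" by (simp add: 2 matrix_mul_assoc)
  also have "\<dots> = Y" using Y by (simp add: 1 is_pseudoinverse_def matrix_mul_assoc)
  finally show ?thesis .
qed

lemma pseudoinverse_eqI: "is_pseudoinverse A X \<Longrightarrow> pseudoinverse A = X"
  unfolding pseudoinverse_def by (rule the_equality) (auto intro: is_pseudoinverse_unique)

lemma matrix_mult_outer_prod: "Q ** outer_prod x y = outer_prod (Q *v x) y"
  by (simp add: vec_eq_iff outer_prod_nth matrix_matrix_mult_def matrix_vector_mult_def
      sum_distrib_right mult.assoc)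

lemma matrix_add_mult: "(A + B) ** C = A ** C + B ** C" for A B :: "real^'n^'m"
  by (simp add: vec_eq_iff matrix_matrix_mult_def distrib_right sum.distrib)

lemma outer_prod_add: "outer_prod x z + outer_prod y z = outer_prod (x + y) z"
  by (simp add: vec_eq_iff outer_prod_nth algebra_simps)

lemma outer_prod_minus: "- outer_prod x z = outer_prod (- x) z"
  by (simp add: vec_eq_iff outer_prod_nth)

lemma outer_prod_zero: "outer_prod 0 z = 0"
  by (simp add: vec_eq_iff outer_prod_nth)

lemma equiv_simplex_equiv: "equiv {S. is_simplex S} simplex_equiv"
proof (rule equivI)
  show "simplex_equiv \<subseteq> {S. is_simplex S} \<times> {S. is_simplex S}"
    by (auto simp: simplex_equiv_def)
  have "\<exists>Q x. orthogonal_matrix Q \<and> S = Q ** S + outer_prod x 1" for S :: "real^'n^'d"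
    by (rule exI[of _ "mat 1"], rule exI[of _ 0]) (simp add: orthogonal_matrix_id outer_prod_zero)
  then show "refl_on {S. is_simplex S} (simplex_equiv :: ((real^'n^'d) \<times> (real^'n^'d)) set)"
    by (auto simp: refl_on_def simplex_equiv_def)
  show "sym (simplex_equiv :: ((real^'n^'d) \<times> (real^'n^'d)) set)"
  proof (rule symI)
    fix S S' :: "real^'n^'d"
    assume "(S, S') \<in> simplex_equiv"
    then obtain Q x where S: "is_simplex S" "is_simplex S'" and Q: "orthogonal_matrix Q"
      and eq: "S' = Q ** S + outer_prod x 1"
      by (auto simp: simplex_equiv_def)
    have "transpose Q ** S' + outer_prod (- (transpose Q *v x)) 1 = transpose Q ** Q ** S"
      by (simp add: eq matrix_add_ldistrib matrix_mult_outer_prod matrix_mul_assoc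
          flip: outer_prod_minus)
    also have "\<dots> = S" using Q by (simp add: orthogonal_matrix_def)
    finally show "(S', S) \<in> simplex_equiv"
      using S Q by (force simp: simplex_equiv_def intro!: exI[of _ "transpose Q"])
  qed
  show "trans (simplex_equiv :: ((real^'n^'d) \<times> (real^'n^'d)) set)"
  proof (rule transI)
    fix S S' S'' :: "real^'n^'d"
    assume "(S, S') \<in> simplex_equiv" "(S', S'') \<in> simplex_equiv"
    then obtain Q x R y where S: "is_simplex S" "is_simplex S''"
      and Q: "orthogonal_matrix Q" and R: "orthogonal_matrix R"
      and eq: "S' = Q ** S + outer_prod x 1" "S'' = R ** S' + outer_prod y 1"
      by (auto simp: simplex_equiv_def)
    have "S'' = R ** Q ** S + outer_prod (R *v x + y) 1"
      by (simp add: eq matrix_add_ldistrib matrix_mult_outer_prod matrix_mul_assoc add.assoc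
          flip: outer_prod_add)
    then show "(S, S'') \<in> simplex_equiv"
      using S orthogonal_matrix_mul[OF R Q] by (auto simp: simplex_equiv_def)
  qed
qed

lemma outer_prod_centering: "outer_prod x 1 ** (centering :: real^'n^'n) = 0"
proof -
  have "(\<Sum>k\<in>UNIV. x $ i * (centering :: real^'n^'n) $ k $ j) = 0" for i j
  proof -
    have "(\<Sum>k\<in>UNIV. (centering :: real^'n^'n) $ k $ j)
        = (\<Sum>k\<in>UNIV. if k = j then 1 else 0) - (\<Sum>k\<in>(UNIV :: 'n set). 1 / real CARD('n))"
      unfolding sum_subtractf[symmetric]
      by (rule sum.cong) (simp_all add: centering_def mat_def outer_prod_nth)
    also have "\<dots> = 0" by simp
    finally show ?thesis by (simp only: sum_distrib_left[symmetric] mult_zero_right)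
  qed
  then show ?thesis by (simp add: vec_eq_iff outer_prod_nth matrix_matrix_mult_def)
qed

lemma simplex_gram_equiv:
  fixes S S' :: "real^'n^'d"
  assumes "(S, S') \<in> simplex_equiv"
  shows "simplex_gram S = simplex_gram S'"
proof -
  obtain Q x where Q: "orthogonal_matrix Q" and eq: "S' = Q ** S + outer_prod x 1"
    using assms by (auto simp: simplex_equiv_def)
  have gram: "simplex_gram T = transpose (T ** centering) ** (T ** centering)" for T :: "real^'n^'d"
    by (simp add: simplex_gram_def matrix_transpose_mul matrix_mul_assoc)
  have "S' ** centering = Q ** (S ** centering)"
    by (simp add: eq matrix_add_mult outer_prod_centering matrix_mul_assoc)
  then have "simplex_gram S' =
      transpose (S ** centering) ** (transpose Q ** Q) ** (S ** centering)"
    unfolding gram by (simp add: matrix_transpose_mul matrix_mul_assoc)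
  also have "\<dots> = simplex_gram S"
    using Q by (simp add: orthogonal_matrix_def gram)
  finally show ?thesis ..
qed

lemma canonical_gram_eq:
  assumes "\<S> \<in> Simplices" "S \<in> \<S>"
  shows "canonical_gram \<S> = simplex_gram S"
proof -
  have "(SOME S. S \<in> \<S>) \<in> \<S>" using assms(2) by (rule someI)
  then have "((SOME S. S \<in> \<S>), S) \<in> simplex_equiv"
    using assms quotient_eq_iff[OF equiv_simplex_equiv] by (metis Simplices_def)
  then show ?thesis unfolding canonical_gram_def by (rule simplex_gram_equiv)
qed

lemma is_simplex_sub_matrix:
  fixes S :: "real^'n^'d" and \<iota> :: "'v::finite \<Rightarrow> 'n"
  assumes S: "is_simplex S" and \<iota>: "inj \<iota>"
  shows "is_simplex (sub_matrix id \<iota> S)"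
  unfolding is_simplex_def
proof
  fix b
  have col: "column a (sub_matrix id \<iota> S) = column (\<iota> a) S" for a
    by (simp add: vec_eq_iff column_def sub_matrix_def)
  let ?f = "\<lambda>i. column i S - column (\<iota> b) S"
  have sub: "\<iota> ` (- {b}) \<subseteq> - {\<iota> b}" using \<iota> by (auto dest: injD)
  have "inj_on (?f \<circ> \<iota>) (- {b})"
    using S sub inj_on_subset[OF \<iota> subset_UNIV]
    by (intro comp_inj_on) (auto simp: is_simplex_def intro: inj_on_subset)
  moreover have "independent (?f ` (- {\<iota> b}))"
    using S by (simp add: is_simplex_def)
  then have "independent (?f ` \<iota> ` (- {b}))"
    by (rule independent_mono) (use sub in \<open>rule image_mono\<close>)
  ultimately show "inj_on (\<lambda>a. column a (sub_matrix id \<iota> S) - column b (sub_matrix id \<iota> S)) (- {b}) \<and>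
      independent ((\<lambda>a. column a (sub_matrix id \<iota> S) - column b (sub_matrix id \<iota> S)) ` (- {b}))"
    by (simp add: col o_def image_image)
qed

lemma face_eq:
  fixes \<S> :: "(real^'n^'d) set" and \<iota> :: "'v::finite \<Rightarrow> 'n"
  assumes \<S>: "\<S> \<in> Simplices" "S \<in> \<S>" and \<iota>: "inj \<iota>"
  shows "face \<iota> \<S> = simplex_equiv `` {sub_matrix id \<iota> S}"
proof -
  have "(sub_matrix id \<iota> S, sub_matrix id \<iota> S') \<in> simplex_equiv" if "S' \<in> \<S>" for S'
  proof -
    have "(S, S') \<in> simplex_equiv"
      using \<S> that quotient_eq_iff[OF equiv_simplex_equiv] by (metis Simplices_def)
    then obtain Q x where S: "is_simplex S" "is_simplex S'" and Q: "orthogonal_matrix Q"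
      and eq: "S' = Q ** S + outer_prod x 1"
      by (auto simp: simplex_equiv_def)
    have "sub_matrix id \<iota> S' = Q ** sub_matrix id \<iota> S + outer_prod x 1"
      by (simp add: eq vec_eq_iff sub_matrix_def outer_prod_nth matrix_matrix_mult_def)
    moreover have "is_simplex (sub_matrix id \<iota> S)" "is_simplex (sub_matrix id \<iota> S')"
      using S \<iota> by (simp_all add: is_simplex_sub_matrix)
    ultimately show ?thesis
      using Q unfolding simplex_equiv_def by blast
  qed
  then have "simplex_equiv `` {sub_matrix id \<iota> S'} = simplex_equiv `` {sub_matrix id \<iota> S}"
    if "S' \<in> \<S>" for S'
    using that equiv_class_eq[OF equiv_simplex_equiv] by metis
  then show ?thesis using \<S>(2) unfolding face_def by blast
qed

lemma face_in_Simplices: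
  fixes \<S> :: "(real^'n^'d) set" and \<iota> :: "'v::finite \<Rightarrow> 'n"
  assumes \<S>: "\<S> \<in> Simplices" and \<iota>: "inj \<iota>"
  shows "face \<iota> \<S> \<in> Simplices"
proof -
  obtain S where S: "is_simplex S" "\<S> = simplex_equiv `` {S}"
    using \<S> by (auto simp: Simplices_def elim!: quotientE)
  then have "S \<in> \<S>" using equiv_class_self[OF equiv_simplex_equiv] by auto
  then show ?thesis
    using S is_simplex_sub_matrix[OF S(1) \<iota>] \<S> \<iota>
    by (simp add: face_eq Simplices_def quotientI)
qed

end

theory Submission
  imports Defs
begin

text \<open>
  A Gram matrix \<open>M = M(\<S>)\<close> is symmetric with kernel spanned by the all-one vector \<open>u\<close>, so its
  pseudoinverse is the symmetric matrix \<open>P\<close> determined by \<open>P u = 0\<close> and \<open>P M = C\<close>, the centering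
  projection. Eliminating \<open>\<V>\<^sup>c\<close> from the block form of these two equations gives, for the Schur
  complement \<open>K = P/\<V>\<^sup>c\<close>, that \<open>K u = 0\<close> and \<open>K M\<^bsub>\<V>\<V>\<^esub> = I + y u\<^sup>T\<close> for some \<open>y\<close>. Since the Gram
  matrix of the face is \<open>C' M\<^bsub>\<V>\<V>\<^esub> C'\<close> with \<open>C'\<close> the centering projection on \<open>\<V>\<close>, and \<open>u\<^sup>T C' = 0\<close>, \<open>K\<close> is
  characterised in the same way as the pseudoinverse of that Gram matrix.
\<close>

section \<open>Matrix algebra and inverses of symmetric matrices\<close>

lemma matrix_diff_mult: "(A - B) ** C = A ** C - B ** C" for A B :: "real^'n^'m"
  by (simp add: vec_eq_iff matrix_matrix_mult_def left_diff_distrib sum_subtractf)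

lemma matrix_mult_diff: "A ** (B - C) = A ** B - A ** C" for A :: "real^'n^'m"
  by (simp add: vec_eq_iff matrix_matrix_mult_def right_diff_distrib sum_subtractf)

lemma outer_prod_mult_vec: "outer_prod x y *v z = (y \<bullet> z) *\<^sub>R x"
  by (simp add: vec_eq_iff outer_prod_nth matrix_vector_mult_def inner_vec_def mult_ac
      flip: sum_distrib_left)

lemma transpose_diff: "transpose (A - B) = transpose A - transpose B" for A B :: "real^'n^'m"
  by (simp add: vec_eq_iff transpose_def)

lemma invertible_if_kernel_zero:
  fixes A :: "real^'n^'n"
  assumes "\<And>x. A *v x = 0 \<Longrightarrow> x = 0"
  shows "invertible A"
  using assms by (simp add: invertible_left_inverse matrix_left_invertible_ker)

lemma matrix_inv_left: "invertible A \<Longrightarrow> matrix_inv A ** A = mat 1"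
  and matrix_inv_right: "invertible A \<Longrightarrow> A ** matrix_inv A = mat 1"
  for A :: "real^'n^'n"
  unfolding invertible_def matrix_inv_def by (metis (mono_tags, lifting) someI_ex)+

lemma matrix_inv_mult_vec: "invertible A \<Longrightarrow> A *v x = y \<Longrightarrow> matrix_inv A *v y = x"
  for A :: "real^'n^'n"
  by (auto simp: matrix_vector_mul_assoc matrix_inv_left)

lemma transpose_matrix_inv:
  fixes A :: "real^'n^'n"
  assumes "invertible A" "transpose A = A"
  shows "transpose (matrix_inv A) = matrix_inv A"
proof -
  have "transpose (matrix_inv A) ** A = transpose (A ** matrix_inv A)"
    using assms(2) by (simp add: matrix_transpose_mul)
  also have "\<dots> = mat 1" using assms(1) by (simp add: matrix_inv_right)
  finally have "transpose (matrix_inv A) ** (A ** matrix_inv A) = matrix_inv A"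
    by (simp add: matrix_mul_assoc)
  then show ?thesis using assms(1) by (simp add: matrix_inv_right)
qed


subsection \<open>The centering projection\<close>

text \<open>The vector \<open>(1/n) A u\<close> is the mean of the columns, so centering on the
  right moves their centroid to the origin. A matrix that kills \<open>u\<close> is left
  unchanged.\<close>

lemma mult_centering:
  fixes A :: "real^'n^'m"
  shows "A ** centering = A - outer_prod ((1 / real CARD('n)) *\<^sub>R (A *v 1)) 1"
proof -
  have "A ** ((1 / real CARD('n)) *\<^sub>R outer_prod 1 1)
      = outer_prod ((1 / real CARD('n)) *\<^sub>R (A *v 1)) (1 :: real^'n)"
    by (simp add: vec_eq_iff matrix_matrix_mult_def matrix_vector_mult_def outer_prod_nth
        sum_divide_distrib)
  then show ?thesis by (simp add: centering_def matrix_mult_diff)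
qed

lemma mult_centering_eq: "A *v 1 = 0 \<Longrightarrow> A ** centering = A" for A :: "real^'n^'m"
  by (simp add: mult_centering outer_prod_zero)

lemma transpose_centering: "transpose centering = centering"
  by (auto simp: vec_eq_iff transpose_def centering_def mat_def outer_prod_nth)

lemma centering_mult_vec:
  "(centering :: real^'n^'n) *v x = x - ((1 \<bullet> x) / real CARD('n)) *\<^sub>R 1"
proof -
  have "((1 / real CARD('n)) *\<^sub>R outer_prod 1 1) *v x = ((1 \<bullet> x) / real CARD('n)) *\<^sub>R (1 :: real^'n)"
    by (simp add: scaleR_matrix_vector_assoc[symmetric] outer_prod_mult_vec)
  then show ?thesis by (simp add: centering_def matrix_vector_mult_diff_rdistrib)
qed

lemma inner_one_one: "(1 :: real^'n) \<bullet> 1 = real CARD('n)"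
  by (simp add: inner_vec_def)

lemma centering_mult_one: "centering *v 1 = 0"
  by (simp add: centering_mult_vec inner_one_one)

lemma centering_idem: "centering ** centering = centering"
  by (simp add: mult_centering_eq centering_mult_one)


subsection \<open>Gram matrices and their pseudoinverses\<close>

lemma simplex_gram_eq: "simplex_gram S = transpose (S ** centering) ** (S ** centering)"
  by (simp add: simplex_gram_def matrix_transpose_mul matrix_mul_assoc)

lemma transpose_simplex_gram: "transpose (simplex_gram S) = simplex_gram S"
  by (simp add: simplex_gram_eq matrix_transpose_mul)

lemma simplex_gram_mult_one: "simplex_gram S *v 1 = 0"
  by (simp add: simplex_gram_def centering_mult_one flip: matrix_vector_mul_assoc)

lemma inner_simplex_gram:
  "x \<bullet> (simplex_gram S *v x) = (norm ((S ** centering) *v x))\<^sup>2"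
proof -
  let ?T = "S ** centering"
  have "x \<bullet> (simplex_gram S *v x) = x \<bullet> (transpose ?T *v (?T *v x))"
    by (simp only: simplex_gram_eq matrix_vector_mul_assoc)
  also have "\<dots> = (?T *v x) \<bullet> (?T *v x)"
    by (metis dot_lmul_matrix transpose_transpose vector_transpose_matrix)
  finally show ?thesis by (simp only: power2_norm_eq_inner)
qed

text \<open>Since \<open>M = T^T T\<close>, the quadratic form is \<open>|T x|^2\<close>; where it
  vanishes, already \<open>T x = 0\<close>.\<close>

lemma simplex_gram_mult_eq_zero:
  assumes "x \<bullet> (simplex_gram S *v x) = 0"
  shows "simplex_gram S *v x = 0"
proof -
  have "(S ** centering) *v x = 0" using assms by (simp add: inner_simplex_gram)
  then show ?thesis by (simp add: simplex_gram_eq flip: matrix_vector_mul_assoc)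
qed

text \<open>Centering \<open>S\<close> only translates it, and the centering over \<open>'v\<close>
  erases translations. The face may therefore be cut out of the centered simplex, whose product
  \<open>T^T T\<close> restricts to a block.\<close>

lemma simplex_gram_sub_matrix:
  fixes S :: "real^'n^'d" and \<iota> :: "'v::finite \<Rightarrow> 'n"
  shows "simplex_gram (sub_matrix id \<iota> S) = centering ** sub_matrix \<iota> \<iota> (simplex_gram S) ** centering"
proof -
  let ?T = "S ** centering"
  obtain y where "?T = S - outer_prod y 1" using mult_centering by blast
  then have "sub_matrix id \<iota> S = sub_matrix id \<iota> ?T + outer_prod y 1"
    by (simp add: vec_eq_iff sub_matrix_def outer_prod_nth)
  then have "sub_matrix id \<iota> S ** centering = sub_matrix id \<iota> ?T ** centering"
    by (simp add: matrix_add_mult outer_prod_centering)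
  moreover have "transpose (sub_matrix id \<iota> ?T) ** sub_matrix id \<iota> ?T
      = sub_matrix \<iota> \<iota> (simplex_gram S)"
    unfolding simplex_gram_eq by (simp add: vec_eq_iff sub_matrix_def matrix_matrix_mult_def transpose_def)
  ultimately show ?thesis
    by (metis simplex_gram_eq matrix_transpose_mul matrix_mul_assoc transpose_centering)
qed

text \<open>Affine independence in matrix form: as the coefficients sum to zero, a base vertex can
  be subtracted from every column without changing the combination.\<close>

lemma simplex_kernel:
  fixes S :: "real^'n^'d"
  assumes S: "is_simplex S" and "S *v x = 0" and "1 \<bullet> x = 0"
  shows "x = 0"
proof -
  have sum: "(\<Sum>i\<in>UNIV. x $ i) = 0" using assms(3) by (simp add: inner_vec_def)
  have lin: "(\<Sum>i\<in>UNIV. x $ i *\<^sub>R column i S) = 0"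
    using assms(2) by (simp add: matrix_mult_sum scalar_mult_eq_scaleR)
  \<comment> \<open>Any vertex serves as the base point.\<close>
  obtain j :: 'n where True by simp
  let ?f = "\<lambda>i. column i S - column j S"
  have inj: "inj_on ?f (- {j})" and ind: "independent (?f ` (- {j}))"
    using S by (auto simp: is_simplex_def)
  have "(\<Sum>i\<in>UNIV. x $ i *\<^sub>R ?f i) = 0"
    using lin sum by (simp add: scaleR_right_diff_distrib sum_subtractf flip: scaleR_left.sum)
  then have "(\<Sum>i\<in>-{j}. x $ i *\<^sub>R ?f i) = 0"
    by (subst (asm) sum.mono_neutral_cong_right[where S = "-{j}" and h = "\<lambda>i. x $ i *\<^sub>R ?f i"]) auto
  then have *: "(\<Sum>v\<in>?f ` (-{j}). x $ (inv_into (-{j}) ?f v) *\<^sub>R v) = 0"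
    unfolding sum.reindex[OF inj] o_def
    by (subst sum.cong[OF refl, of _ _ "\<lambda>i. x $ i *\<^sub>R ?f i"]) (simp_all only: inv_into_f_f[OF inj])
  have off: "x $ i = 0" if "i \<noteq> j" for i
    using independentD[OF ind _ subset_refl *, of "?f i"] inv_into_f_f[OF inj, of i] that by simp
  then have "x $ j = 0" using sum by (simp add: sum.remove[of UNIV j])
  then show ?thesis using off by (metis vec_eq_iff zero_index)
qed

text \<open>A substitute for the Penrose equations, suited to Gram matrices: each condition is
  linear in \<open>P\<close>, so it can be read block by block.\<close>

definition centered_inverse :: "real^'n^'n \<Rightarrow> real^'n^'n \<Rightarrow> bool" where
  "centered_inverse A P \<longleftrightarrow> transpose P = P \<and> P *v 1 = 0 \<and> P ** A = centering"

text \<open>Transposing \<open>P A\<close> gives \<open>A P\<close>, so both products are the same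
  symmetric projection, which \<open>A\<close> and \<open>P\<close> absorb on the right.\<close>

lemma centered_inverse_pseudoinverse:
  assumes A: "transpose A = A" "A ** centering = A" and P: "centered_inverse A P"
  shows "is_pseudoinverse A P"
proof -
  have PA: "P ** A = centering" using P by (simp add: centered_inverse_def)
  then have AP: "A ** P = centering"
    by (metis A(1) P centered_inverse_def matrix_transpose_mul transpose_centering)
  have "P ** centering = P" using P by (simp add: centered_inverse_def mult_centering_eq)
  then show ?thesis using A PA AP
    by (metis is_pseudoinverse_def matrix_mul_assoc transpose_centering)
qed

text \<open>Adding \<open>u u^T\<close> makes the Gram matrix positive definite, because its only
  kernel direction is \<open>u\<close>. Inverting and then projecting \<open>u\<close> away yields
  \<open>P\<close>.\<close>

lemma centered_inverse_exists:
  fixes S :: "real^'n^'d"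
  assumes S: "is_simplex S"
  shows "\<exists>P. centered_inverse (simplex_gram S) P"
proof -
  let ?n = "real CARD('n)" and ?M = "simplex_gram S" and ?J = "outer_prod 1 1 :: real^'n^'n"
  let ?N = "?M + ?J"
  have "x = 0" if "?N *v x = 0" for x
  proof -
    have "x \<bullet> (?M *v x) + (1 \<bullet> x)\<^sup>2 = x \<bullet> (?N *v x)"
      by (simp add: matrix_vector_mult_add_rdistrib inner_add_right outer_prod_mult_vec
          power2_eq_square inner_commute)
    then have sq: "(norm ((S ** centering) *v x))\<^sup>2 + (1 \<bullet> x)\<^sup>2 = 0"
      using that by (simp add: inner_simplex_gram)
    then have "(S ** centering) *v x = 0" and x: "1 \<bullet> x = 0"
      by (simp_all add: sum_power2_eq_zero_iff)
    then have "S *v x = 0"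
      by (simp add: centering_mult_vec flip: matrix_vector_mul_assoc)
    then show ?thesis using S x simplex_kernel by blast
  qed
  then have inv: "invertible ?N" by (rule invertible_if_kernel_zero)
  let ?R = "matrix_inv ?N"
  have "?N *v ((1 / ?n) *\<^sub>R 1) = 1"
    by (simp add: matrix_vector_mult_add_rdistrib matrix_vector_mult_scaleR simplex_gram_mult_one
        outer_prod_mult_vec inner_one_one)
  then have R1: "?R *v 1 = (1 / ?n) *\<^sub>R 1" by (rule matrix_inv_mult_vec[OF inv])
  have N: "transpose ?N = ?N"
    using transpose_simplex_gram[of S] by (simp add: vec_eq_iff transpose_def outer_prod_nth)
  have R: "transpose ?R = ?R" by (rule transpose_matrix_inv[OF inv N])
  let ?P = "?R ** centering"
  \<comment> \<open>One factor \<open>1/n\<close> is the mean taken by centering, the other comes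
    from the eigenvalue \<open>n\<close> of \<open>?N\<close> at \<open>u\<close>.\<close>
  have P: "?P = ?R - (1 / ?n\<^sup>2) *\<^sub>R ?J"
    by (simp add: mult_centering R1 vec_eq_iff outer_prod_nth power2_eq_square)
  have "transpose ?P = ?P"
    unfolding P using R by (simp add: vec_eq_iff transpose_def outer_prod_nth)
  moreover have "?P *v 1 = 0" by (simp add: centering_mult_one flip: matrix_vector_mul_assoc)
  moreover have "?P ** ?M = centering"
  proof -
    have "centering ** ?M = ?M"
      by (simp add: simplex_gram_def transpose_centering matrix_mul_assoc centering_idem)
    then have "?P ** ?M = ?R ** ?M" by (simp flip: matrix_mul_assoc)
    \<comment> \<open>Centering kills the added \<open>u u^T\<close>, so \<open>?M\<close> equals
      \<open>?N ** centering\<close>.\<close>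
    also have "\<dots> = ?R ** ?N ** centering"
      by (metis add.right_neutral matrix_add_mult matrix_mul_assoc mult_centering_eq
          outer_prod_centering simplex_gram_mult_one)
    also have "\<dots> = centering" using inv by (simp add: matrix_inv_left)
    finally show ?thesis .
  qed
  ultimately show ?thesis unfolding centered_inverse_def by blast
qed


subsection \<open>Schur complements\<close>

lemma transpose_sub_matrix: "transpose (sub_matrix \<rho> \<sigma> A) = sub_matrix \<sigma> \<rho> (transpose A)"
  by (simp add: vec_eq_iff transpose_def sub_matrix_def)

context
  fixes \<iota> :: "'v::finite \<Rightarrow> 'n::finite" and \<kappa> :: "'w::finite \<Rightarrow> 'n"
  assumes inj: "inj \<iota>" "inj \<kappa>" and compl: "range \<kappa> = - range \<iota>"
begin

lemma sum_blocks: "(\<Sum>k\<in>UNIV. f k) = (\<Sum>a\<in>UNIV. f (\<iota> a)) + (\<Sum>b\<in>UNIV. f (\<kappa> b))"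
  for f :: "'n \<Rightarrow> real"
proof -
  have "(\<Sum>k\<in>UNIV. f k) = (\<Sum>k\<in>range \<iota>. f k) + (\<Sum>k\<in>range \<kappa>. f k)"
    unfolding compl by (subst sum.union_disjoint[symmetric]) auto
  then show ?thesis using inj by (simp add: sum.reindex)
qed

lemma sub_matrix_mult:
  "sub_matrix \<rho> \<sigma> (A ** B) =
    sub_matrix \<rho> \<iota> A ** sub_matrix \<iota> \<sigma> B + sub_matrix \<rho> \<kappa> A ** sub_matrix \<kappa> \<sigma> B"
  for A :: "real^'n^'m"
  by (simp add: vec_eq_iff sub_matrix_def matrix_matrix_mult_def sum_blocks)

lemma sub_matrix_mult_one:
  "A *v 1 = 0 \<Longrightarrow> sub_matrix \<rho> \<iota> A *v 1 + sub_matrix \<rho> \<kappa> A *v 1 = 0"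
  for A :: "real^'n^'m"
  by (simp add: vec_eq_iff sub_matrix_def matrix_vector_mult_def sum_blocks)

text \<open>A kernel vector of the block, extended by zero to \<open>x\<close>, has
  \<open>x^T P x = 0\<close>. Since \<open>P M P = P\<close>, the semidefinite form of
  \<open>M\<close> vanishes at \<open>P x\<close>, so \<open>M P x\<close>, which is the centered
  \<open>x\<close>, is zero. Thus \<open>x\<close> is constant, and it is zero on the range of
  \<open>\<iota>\<close>.\<close>

lemma invertible_block:
  assumes P: "centered_inverse (simplex_gram S) P"
  shows "invertible (sub_matrix \<kappa> \<kappa> P)"
proof (rule invertible_if_kernel_zero)
  fix z assume z: "sub_matrix \<kappa> \<kappa> P *v z = 0"
  let ?M = "simplex_gram S"
  define x :: "real^'n" where "x = (\<chi> i. if i \<in> range \<kappa> then z $ inv \<kappa> i else 0)"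
  have x\<kappa>: "x $ \<kappa> b = z $ b" for b using inj by (simp add: x_def)
  have x\<iota>: "x $ \<iota> a = 0" for a using compl by (auto simp: x_def)
  have Px: "(P *v x) $ \<kappa> b = 0" for b
    using z by (simp add: vec_eq_iff matrix_vector_mult_def sub_matrix_def sum_blocks x\<kappa> x\<iota>)
  have "x \<bullet> (P *v x) = 0"
    unfolding inner_vec_def by (subst sum_blocks) (simp add: x\<iota> Px)
  have PM: "P ** ?M = centering" and Pt: "transpose P = P" and P1: "P *v 1 = 0"
    using P by (auto simp: centered_inverse_def)
  have MP: "?M ** P = centering"
    by (metis PM Pt matrix_transpose_mul transpose_centering transpose_simplex_gram)
  have "(P *v x) \<bullet> (?M *v (P *v x)) = x \<bullet> (P *v (?M *v (P *v x)))"
    by (metis Pt dot_lmul_matrix vector_transpose_matrix)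
  also have "P *v (?M *v (P *v x)) = P *v x"
    using mult_centering_eq[OF P1] MP by (simp add: matrix_vector_mul_assoc flip: matrix_mul_assoc)
  finally have "?M *v (P *v x) = 0"
    using \<open>x \<bullet> (P *v x) = 0\<close> simplex_gram_mult_eq_zero by metis
  then have "centering *v x = 0" using MP by (simp add: matrix_vector_mul_assoc)
  then obtain c where c: "x = c *\<^sub>R 1" by (metis centering_mult_vec eq_iff_diff_eq_0)
  \<comment> \<open>Here \<open>undefined\<close> is just some index of the nonempty type
    \<open>'v\<close>.\<close>
  then have "c = 0" using x\<iota>[of undefined] by simp
  then have "x = 0" using c by simp
  then show "z = 0" by (simp add: vec_eq_iff flip: x\<kappa>)
qed

lemma centered_inverse_schur_complement:
  fixes S :: "real^'n^'d"
  assumes P: "centered_inverse (simplex_gram S) P"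
  shows "centered_inverse (simplex_gram (sub_matrix id \<iota> S)) (schur_complement \<iota> \<kappa> P)"
proof -
  let ?M = "simplex_gram S" and ?K = "schur_complement \<iota> \<kappa> P"
  let ?A = "sub_matrix \<iota> \<iota> P" and ?B = "sub_matrix \<iota> \<kappa> P"
    and ?C = "sub_matrix \<kappa> \<iota> P" and ?D = "sub_matrix \<kappa> \<kappa> P"
  let ?X = "sub_matrix \<iota> \<iota> ?M" and ?Y = "sub_matrix \<kappa> \<iota> ?M"
  let ?c = "1 / real CARD('n)"
  have PM: "P ** ?M = centering" and Pt: "transpose P = P" and P1: "P *v 1 = 0"
    using P by (auto simp: centered_inverse_def)
  have inv: "invertible ?D" by (rule invertible_block[OF P])
  have K: "?K = ?A - ?B ** matrix_inv ?D ** ?C" by (simp add: schur_complement_def)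
  have "transpose (matrix_inv ?D) = matrix_inv ?D"
    by (rule transpose_matrix_inv[OF inv]) (simp add: transpose_sub_matrix Pt)
  then have Kt: "transpose ?K = ?K"
    by (simp add: K transpose_diff matrix_transpose_mul transpose_sub_matrix Pt matrix_mul_assoc)
  \<comment> \<open>The \<open>\<kappa>\<close> rows of \<open>P u = 0\<close> read
    \<open>C u + D u = 0\<close>.\<close>
  have "?D *v (- 1) = ?C *v 1"
    using sub_matrix_mult_one[OF P1, of \<kappa>] by (simp add: vec.neg add_eq_0_iff2)
  then have "matrix_inv ?D *v (?C *v 1) = - 1" by (rule matrix_inv_mult_vec[OF inv])
  then have "?K *v 1 = ?A *v 1 + ?B *v 1"
    by (simp add: K matrix_vector_mult_diff_rdistrib vec.neg flip: matrix_vector_mul_assoc)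
  then have K1: "?K *v 1 = 0" using sub_matrix_mult_one[OF P1, of \<iota>] by simp
  have AX: "?A ** ?X = mat 1 - outer_prod (?c *\<^sub>R 1) 1 - ?B ** ?Y"
  proof -
    have "?A ** ?X + ?B ** ?Y = sub_matrix \<iota> \<iota> centering" by (simp flip: sub_matrix_mult add: PM)
    also have "\<dots> = mat 1 - outer_prod (?c *\<^sub>R 1) 1"
      using inj by (auto simp: vec_eq_iff sub_matrix_def centering_def mat_def outer_prod_nth inj_eq)
    finally show ?thesis by (simp add: algebra_simps)
  qed
  \<comment> \<open>Unlike the diagonal block in \<open>AX\<close>, this block of the centering
    matrix has no identity part, only entries \<open>-1/n\<close>.\<close>
  have CX: "?C ** ?X = outer_prod (- ?c *\<^sub>R 1) 1 - ?D ** ?Y"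
  proof -
    have "\<kappa> b \<noteq> \<iota> a" for a b using compl by auto
    moreover have "?C ** ?X + ?D ** ?Y = sub_matrix \<kappa> \<iota> centering" by (simp flip: sub_matrix_mult add: PM)
    ultimately have "?C ** ?X + ?D ** ?Y = outer_prod (- ?c *\<^sub>R 1) 1"
      by (simp add: vec_eq_iff sub_matrix_def centering_def mat_def outer_prod_nth)
    then show ?thesis by (simp add: algebra_simps)
  qed
  have "matrix_inv ?D ** (?C ** ?X) = outer_prod (matrix_inv ?D *v (- ?c *\<^sub>R 1)) 1 - ?Y"
    unfolding CX using inv
    by (simp only: matrix_mult_diff matrix_mult_outer_prod matrix_mul_assoc matrix_inv_left matrix_mul_lid)
  \<comment> \<open>The term \<open>B Y\<close> is the one occurring in \<open>AX\<close>, so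
    \<open>Y\<close> cancels from \<open>K X\<close>.\<close>
  then have "?B ** matrix_inv ?D ** ?C ** ?X = outer_prod (?B *v (matrix_inv ?D *v (- ?c *\<^sub>R 1))) 1 - ?B ** ?Y"
    by (metis matrix_mul_assoc matrix_mult_diff matrix_mult_outer_prod)
  then have "?K ** ?X = mat 1 - outer_prod (?c *\<^sub>R 1) 1 - outer_prod (?B *v (matrix_inv ?D *v (- ?c *\<^sub>R 1))) 1"
    unfolding K matrix_diff_mult AX by simp
  \<comment> \<open>Both remaining corrections have the form \<open>y u^T\<close>, which centering
    kills.\<close>
  then have "?K ** ?X ** centering = centering"
    by (simp add: matrix_diff_mult outer_prod_centering)
  then have "?K ** simplex_gram (sub_matrix id \<iota> S) = centering"
    by (simp add: simplex_gram_sub_matrix matrix_mul_assoc mult_centering_eq[OF K1])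
  then show ?thesis using Kt K1 by (simp add: centered_inverse_def)
qed

end

text \<open>Gram matrices are constant on a class, so any representative may be used; uniqueness of
  the pseudoinverse does the rest.\<close>

lemma canonical_pinv_gram_eqI:
  assumes "\<S> \<in> Simplices" "S \<in> \<S>" "centered_inverse (simplex_gram S) P"
  shows "canonical_pinv_gram \<S> = P"
  unfolding canonical_pinv_gram_def canonical_gram_eq[OF assms(1,2)]
  by (intro pseudoinverse_eqI centered_inverse_pseudoinverse assms(3) transpose_simplex_gram
      mult_centering_eq simplex_gram_mult_one)

theorem proposition4:
  fixes \<S> :: "(real^'n^'d) set" and V :: "'n set"
    and \<iota> :: "'v::finite \<Rightarrow> 'n" and \<kappa> :: "'w::finite \<Rightarrow> 'n"
  assumes "\<S> \<in> Simplices"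
    and "V \<noteq> {}" and "V \<subset> UNIV"
    and "bij_betw \<iota> UNIV V" and "bij_betw \<kappa> UNIV (- V)"
  shows "canonical_pinv_gram (face \<iota> \<S>) = schur_complement \<iota> \<kappa> (canonical_pinv_gram \<S>)"
proof -
  have inj: "inj \<iota>" "inj \<kappa>" and compl: "range \<kappa> = - range \<iota>"
    using assms(4,5) by (auto simp: bij_betw_def)
  obtain S where S: "is_simplex S" "\<S> = simplex_equiv `` {S}"
    using assms(1) by (auto simp: Simplices_def elim!: quotientE)
  then have mem: "S \<in> \<S>" using equiv_class_self[OF equiv_simplex_equiv] by auto
  have "sub_matrix id \<iota> S \<in> face \<iota> \<S>"
    unfolding face_eq[OF assms(1) mem inj(1)]
    using is_simplex_sub_matrix[OF S(1) inj(1)] equiv_class_self[OF equiv_simplex_equiv] by blast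
  \<comment> \<open>One \<open>P\<close> serves both sides: its Schur complement is a centered
    inverse for the face.\<close>
  moreover obtain P where P: "centered_inverse (simplex_gram S) P"
    using centered_inverse_exists[OF S(1)] by blast
  ultimately have "canonical_pinv_gram (face \<iota> \<S>) = schur_complement \<iota> \<kappa> P"
    using canonical_pinv_gram_eqI face_in_Simplices[OF assms(1) inj(1)]
      centered_inverse_schur_complement[OF inj compl P] by blast
  then show ?thesis by (simp add: canonical_pinv_gram_eqI[OF assms(1) mem P])
qed

end
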